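(* Let $r>1$ be a fixed real number and $n\ge 2$ an integer. For $x\ge 2r$ let $$F_r(x)=\int_{2r}^x\frac{\log\log\sqrt{rt}-\log\log\sqrt{t/r}}{\log t}\,dt.$$ Then, as $x\to\infty$ (with $x\ge 2r$), $$F_r(x)=\sum_{k=1}^{n-1}a_k(r)\frac{x}{\log^{k+1}x}+\mathcal{O}_n\left(\frac{x\log^{2\lfloor n/2\rfloor+1}(2r)\log r}{\log^{n+1}x}\right),$$ where $$a_k(r)=\sum_{j=1}^{\lfloor (k+1)/2\rfloor}\frac{k!}{(2j-1)!}\cdot\frac{2\log^{2j-1}r}{2j-1}.$$
   Context: The implied constant depends only on $n$. *)

theory Defs
  imports "HOL-Analysis.Analysis"
begin

text \<open>For \<open>r > 1\<close> and \<open>t \<ge> 2 * r\<close> we have \<open>t / r \<ge> 2\<close>, so all arguments of \<open>ln\<close> below are positive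
  and the integrand is continuous on the interval of integration.\<close>

definition F_int :: "real \<Rightarrow> real \<Rightarrow> real" where
  "F_int r x = integral {2 * r..x}
     (\<lambda>t. (ln (ln (sqrt (r * t))) - ln (ln (sqrt (t / r)))) / ln t)"

definition a_coeff :: "nat \<Rightarrow> real \<Rightarrow> real" where
  "a_coeff k r = (\<Sum>j = 1..(k + 1) div 2.
     fact k / fact (2 * j - 1) * (2 * ln r ^ (2 * j - 1) / real (2 * j - 1)))"

end

theory Submission
  imports Defs
begin

text \<open>
  Put \<open>L = ln t\<close>, \<open>a = ln r\<close> and \<open>l = ln (2 * r)\<close>. The integrand is \<open>ln ((L + a) / (L - a)) / L\<close>,
  a series in odd powers of \<open>a / L\<close>. Its partial sum differs from the derivative of the main term
  \<open>G\<close> only by \<open>n * a_coeff (n - 1) r / L ^ (n + 1)\<close>, because \<open>a_coeff\<close> satisfies a first-order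
  recursion that makes \<open>G'\<close> telescope. The series remainder is a geometric tail with ratio at most
  \<open>a / l\<close>; as \<open>l - a = ln 2\<close>, summing it costs one factor \<open>l\<close>, which is why the error term carries an
  odd power of \<open>ln (2 * r)\<close>. Integrating gives the error at \<open>x\<close> up to the boundary value
  \<open>G (2 * r)\<close>, which is of the same order.
\<close>

section \<open>Elementary bounds for logarithms and powers\<close>

lemma ln_ge_half:
  fixes t :: real
  assumes "t \<ge> 2"
  shows "ln t \<ge> 1 / 2"
proof -
  have "ln t \<ge> ln 2" using assms by simp
  then show ?thesis using ln2_ge_two_thirds by linarith
qed

text \<open>Since \<open>2 * y >= 1\<close>, raising an exponent costs only a constant. The
  logarithms involved may be below 1, so this is what lets even and odd \<open>n\<close> share the
  exponent \<open>2 * (n div 2) + 2\<close>.\<close>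

lemma power_le_two_power_mult_power:
  fixes y :: real
  assumes "y \<ge> 1 / 2" "p \<le> q"
  shows "y ^ p \<le> 2 ^ q * y ^ q"
proof -
  have "y ^ p * 1 \<le> y ^ p * (2 ^ p * (2 * y) ^ (q - p))"
  proof (rule mult_left_mono)
    have "(1::real) * 1 \<le> 2 ^ p * (2 * y) ^ (q - p)"
      using assms by (intro mult_mono one_le_power) auto
    then show "1 \<le> 2 ^ p * (2 * y) ^ (q - p)" by simp
  qed (use assms in auto)
  also have "\<dots> = (2 ^ p * 2 ^ (q - p)) * (y ^ p * y ^ (q - p))"
    by (simp add: power_mult_distrib)
  also have "\<dots> = 2 ^ q * y ^ q"
    using assms by (simp flip: power_add)
  finally show ?thesis by simp
qed

section \<open>Growth of \<open>t / ln t ^ m\<close> and integrals of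
  \<open>1 / ln t ^ m\<close>\<close>

text \<open>Serves with \<open>c = 0\<close> for the main term and with \<open>c = 2 * m\<close> for
  the comparison function below.\<close>

lemma has_real_derivative_div_ln_power:
  fixes t c :: real
  assumes "t > 0" "ln t + c > 0"
  shows "((\<lambda>t. t / (ln t + c) ^ m) has_real_derivative
    1 / (ln t + c) ^ m - real m / (ln t + c) ^ Suc m) (at t within S)"
proof -
  have "((\<lambda>t. t / (ln t + c) ^ m) has_real_derivative
     (1 * (ln t + c) ^ m - t * (real m * (ln t + c) ^ (m - 1) * (1 / t))) /
      ((ln t + c) ^ m * (ln t + c) ^ m)) (at t within S)"
    using assms by (auto intro!: derivative_eq_intros)
  also have "(1 * (ln t + c) ^ m - t * (real m * (ln t + c) ^ (m - 1) * (1 / t))) /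
      ((ln t + c) ^ m * (ln t + c) ^ m) = 1 / (ln t + c) ^ m - real m / (ln t + c) ^ Suc m"
  proof (cases m)
    case (Suc k)
    define s where "s = ln t + c"
    have "s > 0" using assms by (simp add: s_def)
    then show ?thesis
      unfolding Suc s_def[symmetric] using assms(1) by (simp add: field_simps)
  qed simp
  finally show ?thesis .
qed

text \<open>Replacing \<open>t / ln t ^ m\<close> by the comparable function \<open>t / (ln t + 2 * m) ^ m\<close> yields one that is
  increasing from \<open>t = 2\<close> on, with derivative comparable to \<open>1 / ln t ^ m\<close>.\<close>

lemma div_shifted_ln_power_bounds:
  fixes t :: real
  assumes "t \<ge> 2"
  shows "t / (ln t + 2 * real m) ^ m \<le> t / ln t ^ m"
    and "1 / ln t ^ m \<le> (1 + 4 * real m) ^ m / (ln t + 2 * real m) ^ m"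
proof -
  have L: "ln t \<ge> 1 / 2" by (rule ln_ge_half[OF assms])
  have "ln t ^ m \<le> (ln t + 2 * real m) ^ m"
    using L by (intro power_mono) auto
  then show "t / (ln t + 2 * real m) ^ m \<le> t / ln t ^ m"
    using L assms by (intro divide_left_mono mult_pos_pos zero_less_power) auto
  \<comment> \<open>As \<open>ln t >= 1 / 2\<close>, the shift \<open>2 * m\<close> is at most
    \<open>4 * m * ln t\<close>.\<close>
  have "ln t + 2 * real m \<le> (1 + 4 * real m) * ln t"
    using mult_left_mono[OF L, of "4 * real m"] by (simp add: algebra_simps)
  then have "(ln t + 2 * real m) ^ m \<le> ((1 + 4 * real m) * ln t) ^ m"
    using L by (intro power_mono) auto
  then have "(ln t + 2 * real m) ^ m \<le> (1 + 4 * real m) ^ m * ln t ^ m"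
    by (simp add: power_mult_distrib)
  moreover have "ln t ^ m > 0" "(ln t + 2 * real m) ^ m > 0"
    using L by (auto intro!: zero_less_power)
  ultimately show "1 / ln t ^ m \<le> (1 + 4 * real m) ^ m / (ln t + 2 * real m) ^ m"
    by (simp add: field_simps)
qed

lemma has_integral_deriv_div_shifted_ln_power:
  fixes c x :: real
  assumes "2 \<le> c" "c \<le> x"
  shows "((\<lambda>t. 1 / (ln t + 2 * real m) ^ m - real m / (ln t + 2 * real m) ^ Suc m) has_integral
    x / (ln x + 2 * real m) ^ m - c / (ln c + 2 * real m) ^ m) {c..x}"
proof (rule fundamental_theorem_of_calculus[OF assms(2)])
  fix t assume "t \<in> {c..x}"
  then have "t \<ge> 2" using assms by auto
  with ln_ge_half[of t] show "((\<lambda>t. t / (ln t + 2 * real m) ^ m) has_vector_derivative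
      1 / (ln t + 2 * real m) ^ m - real m / (ln t + 2 * real m) ^ Suc m) (at t within {c..x})"
    unfolding has_real_derivative_iff_has_vector_derivative[symmetric]
    by (intro has_real_derivative_div_ln_power) auto
qed

text \<open>The shift forces \<open>ln t + 2 * m >= 2 * m\<close>, so the subtracted term is at most
  half of the leading one.\<close>

lemma deriv_div_shifted_ln_power_ge:
  fixes t :: real
  assumes "t \<ge> 2"
  shows "1 / (2 * (ln t + 2 * real m) ^ m)
    \<le> 1 / (ln t + 2 * real m) ^ m - real m / (ln t + 2 * real m) ^ Suc m"
proof -
  define s where "s = ln t + 2 * real m"
  have s: "s > 0" "s \<ge> 2 * real m"
    using ln_ge_half[OF assms] by (auto simp: s_def)
  have "real m / s ^ Suc m \<le> (s / 2) / s ^ Suc m"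
    using s by (intro divide_right_mono) auto
  also have "\<dots> = 1 / (2 * s ^ m)" using s by (simp add: field_simps)
  finally show ?thesis unfolding s_def[symmetric] using s by (simp add: field_simps)
qed

text \<open>The function \<open>t / ln t ^ m\<close> itself decreases while \<open>ln t < m\<close>;
  monotonicity is taken from the shifted function, at the cost of a constant. This carries the
  boundary value at \<open>2 * r\<close> over to \<open>x\<close>.\<close>

lemma div_ln_power_le:
  fixes c x :: real
  assumes "2 \<le> c" "c \<le> x"
  shows "c / ln c ^ m \<le> (1 + 4 * real m) ^ m * (x / ln x ^ m)"
proof -
  have "0 \<le> x / (ln x + 2 * real m) ^ m - c / (ln c + 2 * real m) ^ m"
  proof (rule has_integral_nonneg[OF has_integral_deriv_div_shifted_ln_power[OF assms]])
    fix t assume "t \<in> {c..x}"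
    then have t: "t \<ge> 2" using assms by auto
    have "0 \<le> 1 / (2 * (ln t + 2 * real m) ^ m)"
      using ln_ge_half[OF t] by simp
    then show "0 \<le> 1 / (ln t + 2 * real m) ^ m - real m / (ln t + 2 * real m) ^ Suc m"
      using deriv_div_shifted_ln_power_ge[OF t, of m] by linarith
  qed
  moreover have "c / ln c ^ m \<le> (1 + 4 * real m) ^ m * (c / (ln c + 2 * real m) ^ m)"
    using mult_left_mono[OF div_shifted_ln_power_bounds(2)[OF assms(1), of m], of c] assms
    by (simp add: mult_ac)
  ultimately have "c / ln c ^ m \<le> (1 + 4 * real m) ^ m * (x / (ln x + 2 * real m) ^ m)"
    by (smt (verit) mult_left_mono zero_le_power of_nat_0_le_iff)
  also have "\<dots> \<le> (1 + 4 * real m) ^ m * (x / ln x ^ m)"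
    using assms by (intro mult_left_mono div_shifted_ln_power_bounds(1)) auto
  finally show ?thesis .
qed

lemma integrable_inverse_ln_power:
  fixes c x :: real
  assumes "2 \<le> c"
  shows "(\<lambda>t. 1 / ln t ^ m) integrable_on {c..x}"
proof (rule integrable_continuous_real, intro continuous_intros ballI)
  fix t assume "t \<in> {c..x}"
  then show "t \<noteq> 0" "ln t ^ m \<noteq> 0" using assms ln_ge_half[of t] by auto
qed

text \<open>The integrand is dominated by a multiple of the derivative of the shifted function,
  which integrates exactly; the lower endpoint contributes with a favourable sign.\<close>

lemma integral_inverse_ln_power_le:
  fixes c x :: real
  assumes "2 \<le> c" "c \<le> x"
  shows "integral {c..x} (\<lambda>t. 1 / ln t ^ m) \<le> 2 * (1 + 4 * real m) ^ m * (x / ln x ^ m)"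
proof -
  let ?B = "(1 + 4 * real m) ^ m"
  have "integral {c..x} (\<lambda>t. 1 / ln t ^ m)
      \<le> 2 * ?B * (x / (ln x + 2 * real m) ^ m - c / (ln c + 2 * real m) ^ m)"
  proof (rule has_integral_le[OF integrable_integral[OF integrable_inverse_ln_power[OF assms(1)]]
        has_integral_mult_right[OF has_integral_deriv_div_shifted_ln_power[OF assms]]])
    fix t assume "t \<in> {c..x}"
    then have t: "t \<ge> 2" using assms by auto
    have "1 / ln t ^ m \<le> 2 * ?B * (1 / (2 * (ln t + 2 * real m) ^ m))"
      using div_shifted_ln_power_bounds(2)[OF t, of m] by simp
    also have "\<dots> \<le> 2 * ?B *
        (1 / (ln t + 2 * real m) ^ m - real m / (ln t + 2 * real m) ^ Suc m)"
      by (intro mult_left_mono deriv_div_shifted_ln_power_ge[OF t]) auto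
    finally show "1 / ln t ^ m \<le> 2 * ?B *
        (1 / (ln t + 2 * real m) ^ m - real m / (ln t + 2 * real m) ^ Suc m)" .
  qed
  also have "\<dots> \<le> 2 * ?B * (x / ln x ^ m)"
  proof (rule mult_left_mono)
    have "c / (ln c + 2 * real m) ^ m \<ge> 0"
      using assms ln_ge_half[of c] by simp
    then show "x / (ln x + 2 * real m) ^ m - c / (ln c + 2 * real m) ^ m \<le> x / ln x ^ m"
      using div_shifted_ln_power_bounds(1)[of x m] assms by linarith
  qed simp
  finally show ?thesis .
qed

section \<open>Recursion and size of the coefficients\<close>

lemma a_coeff_eq:
  "a_coeff k r = (\<Sum>i<(k + 1) div 2. fact k / fact (2 * i + 1) * (2 * ln r ^ (2 * i + 1) / real (2 * i + 1)))"
  unfolding a_coeff_def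
proof (rule sum.reindex_bij_witness[of _ Suc "\<lambda>j. j - 1"])
  fix j assume "j \<in> {1..(k + 1) div 2}"
  then have "2 * (j - 1) + 1 = 2 * j - 1" by auto
  then show "fact k / fact (2 * (j - 1) + 1) * (2 * ln r ^ (2 * (j - 1) + 1) / real (2 * (j - 1) + 1)) =
      fact k / fact (2 * j - 1) * (2 * ln r ^ (2 * j - 1) / real (2 * j - 1))"
    by simp
qed auto

lemma a_coeff_0: "a_coeff 0 r = 0"
  by (simp add: a_coeff_def)

text \<open>The factor \<open>Suc k\<close> turns \<open>fact k\<close> into
  \<open>fact (Suc k)\<close> in every old term. The range of summation grows only for even
  \<open>k\<close>, and in the new term the two factorials cancel.\<close>

lemma a_coeff_Suc:
  "a_coeff (Suc k) r = real (Suc k) * a_coeff k r +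
     (if even k then 2 * ln r ^ Suc k / real (Suc k) else 0)"
proof -
  let ?h = "\<lambda>k i. fact k / fact (2 * i + 1) * (2 * ln r ^ (2 * i + 1) / real (2 * i + 1))"
  have *: "real (Suc k) * a_coeff k r = (\<Sum>i<(k + 1) div 2. ?h (Suc k) i)"
    unfolding a_coeff_eq sum_distrib_left by (intro sum.cong) simp_all
  show ?thesis
  proof (cases "even k")
    case True
    then obtain i where k: "k = 2 * i" by blast
    have d: "(Suc k + 1) div 2 = Suc ((k + 1) div 2)" "(k + 1) div 2 = i"
      using k by auto
    have "?h (Suc k) i = 2 * ln r ^ Suc k / real (Suc k)"
      unfolding k by (simp del: fact_Suc)
    then show ?thesis
      using True unfolding * a_coeff_eq[of "Suc k"] d by simp
  next
    case False
    then have "(Suc k + 1) div 2 = (k + 1) div 2" by (elim oddE) simp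
    then show ?thesis
      using False unfolding * a_coeff_eq[of "Suc k"] by simp
  qed
qed

lemma a_coeff_nonneg: "r \<ge> 1 \<Longrightarrow> a_coeff k r \<ge> 0"
  unfolding a_coeff_eq by (intro sum_nonneg) auto

text \<open>Expresses that \<open>a_coeff k r\<close> is of order
  \<open>ln r * ln (2 * r) ^ (k - 1)\<close>, uniformly in \<open>r\<close>; the factor
  \<open>ln (2 * r)\<close> on the left avoids a negative exponent at \<open>k = 0\<close>.
  Induction along \<open>a_coeff_Suc\<close>.\<close>

lemma a_coeff_le:
  "\<exists>A\<ge>0. \<forall>r>1. a_coeff k r * ln (2 * r) \<le> A * (ln r * ln (2 * r) ^ k)"
proof (induction k)
  case 0
  show ?case by (auto intro!: exI[of _ 0] simp: a_coeff_0)
next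
  case (Suc k)
  then obtain A where A: "A \<ge> 0"
    "\<And>r. r > 1 \<Longrightarrow> a_coeff k r * ln (2 * r) \<le> A * (ln r * ln (2 * r) ^ k)"
    by blast
  show ?case
  proof (intro exI[of _ "2 * real (Suc k) * A + 2"] conjI allI impI)
    fix r :: real assume r: "r > 1"
    let ?a = "ln r" and ?l = "ln (2 * r)"
    have l: "?l \<ge> 1 / 2" using r by (intro ln_ge_half) auto
    have a: "?a > 0" "?a \<le> ?l" using r by auto
    have "(if even k then 2 * ?a ^ Suc k / real (Suc k) else 0) \<le> 2 * ?a ^ Suc k"
      using a by (auto simp: field_simps intro!: mult_nonneg_nonneg)
    also have "\<dots> \<le> 2 * (?a * ?l ^ k)"
      using a by (auto intro!: mult_left_mono power_mono)
    finally have *: "(if even k then 2 * ?a ^ Suc k / real (Suc k) else 0) * ?l \<le> 2 * (?a * ?l ^ k) * ?l"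
      using l by (intro mult_right_mono) auto
    have "real (Suc k) * a_coeff k r * ?l \<le> real (Suc k) * (A * (?a * ?l ^ k))"
      using mult_left_mono[OF A(2)[OF r], of "real (Suc k)"] by (simp add: mult.assoc)
    \<comment> \<open>The missing factor \<open>ln (2 * r)\<close> is supplied by
      \<open>2 * ln (2 * r) >= 1\<close>, which doubles the constant.\<close>
    also have "\<dots> \<le> real (Suc k) * (A * (?a * ?l ^ k)) * (2 * ?l)"
      using l a A(1) mult_left_mono[of 1 "2 * ?l" "real (Suc k) * (A * (?a * ?l ^ k))"] by simp
    finally show "a_coeff (Suc k) r * ?l \<le> (2 * real (Suc k) * A + 2) * (?a * ?l ^ Suc k)"
      using * unfolding a_coeff_Suc by (simp add: algebra_simps)
  qed (use A in auto)
qed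

section \<open>Derivative of the main term\<close>

lemma has_real_derivative_main_term:
  fixes t :: real
  assumes "t > 1"
  shows "((\<lambda>t. \<Sum>k = 1..m. a_coeff k r * (t / ln t ^ (k + 1))) has_real_derivative
     (\<Sum>i<Suc m div 2. 2 * ln r ^ (2 * i + 1) / real (2 * i + 1) / ln t ^ (2 * i + 2))
       - real (Suc m) * a_coeff m r / ln t ^ (m + 2)) (at t within S)"
proof (induction m)
  case 0
  show ?case by (simp add: a_coeff_0)
next
  case (Suc m)
  have L: "ln t > 0" using assms by simp
  have "((\<lambda>t. t / ln t ^ (m + 2)) has_real_derivative
      1 / ln t ^ (m + 2) - real (m + 2) / ln t ^ (m + 3)) (at t within S)"
    using has_real_derivative_div_ln_power[of t 0 "m + 2" S] assms L
    by (simp add: eval_nat_numeral)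
  from DERIV_add[OF Suc DERIV_cmult[OF this, of "a_coeff (Suc m) r"]]
  have "((\<lambda>t. \<Sum>k = 1..Suc m. a_coeff k r * (t / ln t ^ (k + 1))) has_real_derivative
     (\<Sum>i<Suc m div 2. 2 * ln r ^ (2 * i + 1) / real (2 * i + 1) / ln t ^ (2 * i + 2))
       - real (Suc m) * a_coeff m r / ln t ^ (m + 2)
       + a_coeff (Suc m) r * (1 / ln t ^ (m + 2) - real (m + 2) / ln t ^ (m + 3))) (at t within S)"
    by (simp add: eval_nat_numeral)
  also have "(\<Sum>i<Suc m div 2. 2 * ln r ^ (2 * i + 1) / real (2 * i + 1) / ln t ^ (2 * i + 2))
       - real (Suc m) * a_coeff m r / ln t ^ (m + 2)
       + a_coeff (Suc m) r * (1 / ln t ^ (m + 2) - real (m + 2) / ln t ^ (m + 3)) =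
     (\<Sum>i<Suc m div 2. 2 * ln r ^ (2 * i + 1) / real (2 * i + 1) / ln t ^ (2 * i + 2))
       + (a_coeff (Suc m) r - real (Suc m) * a_coeff m r) / ln t ^ (m + 2)
       - real (Suc (Suc m)) * a_coeff (Suc m) r / ln t ^ (Suc m + 2)"
    by (simp add: diff_divide_distrib right_diff_distrib eval_nat_numeral)
  also have "(\<Sum>i<Suc m div 2. 2 * ln r ^ (2 * i + 1) / real (2 * i + 1) / ln t ^ (2 * i + 2))
       + (a_coeff (Suc m) r - real (Suc m) * a_coeff m r) / ln t ^ (m + 2) =
     (\<Sum>i<Suc (Suc m) div 2. 2 * ln r ^ (2 * i + 1) / real (2 * i + 1) / ln t ^ (2 * i + 2))"
    unfolding a_coeff_Suc by (auto elim!: evenE oddE)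
  finally show ?case .
qed

section \<open>Series expansion of the integrand\<close>

lemma ln_ln_sqrt_diff:
  fixes r t :: real
  assumes "r > 1" "t \<ge> 2 * r"
  shows "ln (ln (sqrt (r * t))) - ln (ln (sqrt (t / r))) = ln ((ln t + ln r) / (ln t - ln r))"
proof -
  have pos: "ln r > 0" "ln t > ln r" using assms by auto
  have *: "ln (sqrt (r * t)) = (ln t + ln r) / 2" "ln (sqrt (t / r)) = (ln t - ln r) / 2"
    using assms by (auto simp: ln_sqrt ln_mult ln_div)
  show ?thesis unfolding * using pos by (simp add: ln_div)
qed

lemma integrand_approx:
  fixes r t :: real
  assumes r: "r > 1" and t: "t \<ge> 2 * r"
  shows "\<bar>(ln (ln (sqrt (r * t))) - ln (ln (sqrt (t / r)))) / ln t
      - (\<Sum>i<J. 2 * ln r ^ (2 * i + 1) / real (2 * i + 1) / ln t ^ (2 * i + 2))\<bar>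
    \<le> 4 * (ln r * ln (2 * r) ^ (2 * J + 1)) / ln t ^ (2 * J + 2)"
proof -
  define a L l where "a = ln r" and "L = ln t" and "l = ln (2 * r)"
  have l: "l = a + ln 2" using r by (simp add: a_def l_def ln_mult)
  have a: "a > 0" using r by (simp add: a_def)
  have lL: "l \<le> L" using r t by (simp add: l_def L_def)
  have ln2: "ln 2 \<ge> (1 / 2 :: real)" by (rule ln_ge_half) simp
  have aL: "a < L" "l > 0" "L > 0" "a \<le> l" using l a lL ln2 by linarith+
  define x where "x = (L + a) / (L - a)"
  define S where "S = (\<Sum>i<J. 2 * (a / L) ^ (2 * i + 1) / real (2 * i + 1))"
  define d where "d = (a / L) ^ (2 * J + 1) / (1 - (a / L)\<^sup>2) / real (2 * J + 1)"
  have x: "x > 1" using a aL by (simp add: x_def field_simps)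
  \<comment> \<open>The series of \<open>ln x\<close> runs over odd powers of
    \<open>(x - 1) / (x + 1)\<close>, hence of \<open>a / L\<close>; \<open>ln_approx_bounds\<close>
    encloses \<open>ln x\<close> between \<open>S\<close> and \<open>S\<close> plus twice the
    geometric tail \<open>d\<close>.\<close>
  have y: "(x - 1) / (x + 1) = a / L" using a aL by (simp add: x_def field_simps)
  have "ln x \<in> {S..S + 2 * d}"
    using ln_approx_bounds[OF x, of J] unfolding y S_def d_def by (simp add: mult_ac)
  moreover have "d \<le> (a / L) ^ (2 * J + 1) * (2 * l)"
  proof -
    \<comment> \<open>The gap \<open>l - a = ln 2\<close> keeps \<open>a / L\<close> below 1 by at
      least \<open>1 / (2 * l)\<close>, so the geometric factor is at most \<open>2 * l\<close> for
      all \<open>t\<close>.\<close>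
    have al: "a \<le> l - 1 / 2" using l ln2 by linarith
    have "a / L \<le> a / l" using a aL lL by (intro divide_left_mono) auto
    also have "a / l \<le> 1 - 1 / (2 * l)" using aL al by (simp add: field_simps)
    finally have 1: "1 / (2 * l) \<le> 1 - a / L" by simp
    have "(a / L)\<^sup>2 \<le> a / L"
      using a aL power_decreasing[of 1 2 "a / L"] by simp
    with 1 have 2: "1 / (2 * l) \<le> 1 - (a / L)\<^sup>2" by linarith
    have 3: "0 < 1 / (2 * l)" using aL by simp
    with 2 have 4: "0 < 1 - (a / L)\<^sup>2" by linarith
    have 5: "0 \<le> (a / L) ^ (2 * J + 1)" using a aL by simp
    have "(a / L) ^ (2 * J + 1) / (1 - (a / L)\<^sup>2) \<le> (a / L) ^ (2 * J + 1) / (1 / (2 * l))"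
      using 2 5 mult_pos_pos[OF 4 3] by (rule divide_left_mono)
    moreover have "d \<le> (a / L) ^ (2 * J + 1) / (1 - (a / L)\<^sup>2) / 1"
      unfolding d_def by (rule divide_left_mono[OF _ divide_nonneg_pos[OF 5 4]]) auto
    ultimately have "d \<le> (a / L) ^ (2 * J + 1) / (1 / (2 * l))" by linarith
    then show ?thesis by simp
  qed
  ultimately have "\<bar>ln x - S\<bar> \<le> 4 * ((a / L) ^ (2 * J + 1) * l)" by auto
  then have "\<bar>ln x - S\<bar> / L \<le> 4 * ((a / L) ^ (2 * J + 1) * l) / L"
    using aL by (intro divide_right_mono) auto
  also have "\<dots> = 4 * (a * (a ^ (2 * J) * l)) / L ^ (2 * J + 2)"
    using aL by (simp add: power_divide field_simps)
  \<comment> \<open>One factor \<open>a\<close> is kept as the \<open>ln r\<close> of the error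
    term; the others are raised to \<open>l\<close>.\<close>
  also have "\<dots> \<le> 4 * (a * (l ^ (2 * J) * l)) / L ^ (2 * J + 2)"
    using a aL by (intro divide_right_mono mult_left_mono mult_right_mono power_mono) auto
  also have "\<dots> = 4 * (a * l ^ (2 * J + 1)) / L ^ (2 * J + 2)" by simp
  also have "\<bar>ln x - S\<bar> / L = \<bar>ln x / L - S / L\<bar>"
    using aL by (simp add: diff_divide_distrib[symmetric])
  also have "S / L = (\<Sum>i<J. 2 * a ^ (2 * i + 1) / real (2 * i + 1) / L ^ (2 * i + 2))"
    unfolding S_def sum_divide_distrib
    using aL by (intro sum.cong) (auto simp: power_divide field_simps)
  finally show ?thesis
    unfolding ln_ln_sqrt_diff[OF r t] by (simp add: x_def a_def L_def l_def)
qed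

lemma F_integrand_integrable:
  fixes r x :: real
  assumes "r > 1"
  shows "(\<lambda>t. (ln (ln (sqrt (r * t))) - ln (ln (sqrt (t / r)))) / ln t) integrable_on {2 * r..x}"
proof (rule integrable_continuous_real, intro continuous_intros ballI)
  fix t assume "t \<in> {2 * r..x}"
  then have t: "t \<ge> 2 * r" by simp
  have "1 < r * t" using assms t by (intro less_1_mult) auto
  then show "ln (sqrt (r * t)) \<noteq> 0" "sqrt (r * t) \<noteq> 0" by (auto simp: ln_sqrt)
  have "1 < t / r" using assms t by (simp add: field_simps)
  then show "ln (sqrt (t / r)) \<noteq> 0" "sqrt (t / r) \<noteq> 0" by (auto simp: ln_sqrt simp del: less_divide_eq_1)
  show "t \<noteq> 0" "ln t \<noteq> 0" "r \<noteq> 0" using assms t by auto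
qed

section \<open>Error estimates uniform in \<open>r\<close>\<close>

text \<open>By \<open>a_coeff_le\<close> every summand is of order
  \<open>r * ln r / ln (2 * r) ^ 2\<close>, whatever \<open>k\<close> is, and this is within the
  claimed bound up to a constant.\<close>

lemma main_term_initial_bound:
  "\<exists>K\<ge>0. \<forall>r>1. \<bar>\<Sum>k = 1..n - 1. a_coeff k r * (2 * r / ln (2 * r) ^ (k + 1))\<bar>
    \<le> K * (ln r * ln (2 * r) ^ (2 * (n div 2) + 1)) * (2 * r / ln (2 * r) ^ (n + 1))"
proof -
  obtain A where A: "\<And>k. A k \<ge> 0"
    "\<And>k r. r > 1 \<Longrightarrow> a_coeff k r * ln (2 * r) \<le> A k * (ln r * ln (2 * r) ^ k)"
    using a_coeff_le by metis
  define J where "J = n div 2"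
  show ?thesis
  proof (intro exI[of _ "(\<Sum>k = 1..n - 1. A k) * 2 ^ (2 * J + 2)"] conjI allI impI)
    show "0 \<le> (\<Sum>k = 1..n - 1. A k) * 2 ^ (2 * J + 2)" by (simp add: A sum_nonneg)
    fix r :: real assume r: "r > 1"
    define a l where "a = ln r" and "l = ln (2 * r)"
    have l: "l \<ge> 1 / 2" unfolding l_def using r by (intro ln_ge_half) auto
    have a: "a > 0" using r by (simp add: a_def)
    have lJ: "l ^ n \<le> 2 ^ (2 * J + 2) * l ^ (2 * J + 2)"
      using l by (intro power_le_two_power_mult_power) (auto simp: J_def)
    have "a_coeff k r * (2 * r / l ^ (k + 1))
        \<le> A k * (2 ^ (2 * J + 2) * (a * l ^ (2 * J + 1)) * (2 * r / l ^ (n + 1)))" for k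
    proof -
      have "a_coeff k r * (2 * r / l ^ (k + 1)) = (a_coeff k r * l) * (2 * r / l ^ (k + 2))"
        using l by (simp add: field_simps)
      also have "\<dots> \<le> (A k * (a * l ^ k)) * (2 * r / l ^ (k + 2))"
        using A(2)[OF r, of k] l r unfolding a_def l_def by (intro mult_right_mono) auto
      \<comment> \<open>A common denominator makes the single estimate \<open>lJ\<close> serve all
        \<open>k\<close>.\<close>
      also have "\<dots> = A k * a * 2 * r / l ^ (n + 2) * l ^ n"
        using l by (simp add: power_add field_simps power2_eq_square)
      also have "\<dots> \<le> A k * a * 2 * r / l ^ (n + 2) * (2 ^ (2 * J + 2) * l ^ (2 * J + 2))"
        using l a A r by (intro mult_left_mono lJ) auto
      also have "\<dots> = A k * (2 ^ (2 * J + 2) * (a * l ^ (2 * J + 1)) * (2 * r / l ^ (n + 1)))"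
        using l by (simp add: power_add field_simps)
      finally show ?thesis .
    qed
    then have "(\<Sum>k = 1..n - 1. a_coeff k r * (2 * r / l ^ (k + 1)))
        \<le> (\<Sum>k = 1..n - 1. A k) * 2 ^ (2 * J + 2) * (a * l ^ (2 * J + 1)) * (2 * r / l ^ (n + 1))"
      unfolding sum_distrib_right by (intro sum_mono) (simp only: mult.assoc)
    moreover have "0 \<le> (\<Sum>k = 1..n - 1. a_coeff k r * (2 * r / l ^ (k + 1)))"
      using r l by (intro sum_nonneg mult_nonneg_nonneg a_coeff_nonneg) auto
    ultimately show "\<bar>\<Sum>k = 1..n - 1. a_coeff k r * (2 * r / ln (2 * r) ^ (k + 1))\<bar>
      \<le> (\<Sum>k = 1..n - 1. A k) * 2 ^ (2 * J + 2) * (ln r * ln (2 * r) ^ (2 * (n div 2) + 1))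
          * (2 * r / ln (2 * r) ^ (n + 1))"
      by (simp add: a_def l_def J_def)
  qed
qed

text \<open>Two errors add up: the series remainder after \<open>n div 2\<close> terms, and the last
  term left over by the telescoping, controlled by \<open>a_coeff_le\<close>.\<close>

lemma deriv_error_bound:
  "\<exists>K\<ge>0. \<forall>r>1. \<forall>t\<ge>2 * r.
    \<bar>(ln (ln (sqrt (r * t))) - ln (ln (sqrt (t / r)))) / ln t
      - ((\<Sum>i<n div 2. 2 * ln r ^ (2 * i + 1) / real (2 * i + 1) / ln t ^ (2 * i + 2))
          - real n * a_coeff (n - 1) r / ln t ^ (n + 1))\<bar>
    \<le> K * (ln r * ln (2 * r) ^ (2 * (n div 2) + 1)) * (1 / ln t ^ (n + 1))"
proof -
  obtain A where A: "A \<ge> 0"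
    "\<And>r. r > 1 \<Longrightarrow> a_coeff (n - 1) r * ln (2 * r) \<le> A * (ln r * ln (2 * r) ^ (n - 1))"
    using a_coeff_le by metis
  define J where "J = n div 2"
  let ?Q = "2 ^ (2 * J + 2) :: real"
  show ?thesis unfolding J_def[symmetric]
  proof (intro exI[of _ "4 * ?Q + real n * A * ?Q"] conjI allI impI)
    show "0 \<le> 4 * ?Q + real n * A * ?Q" using A by simp
    fix r t :: real assume r: "r > 1" and t: "t \<ge> 2 * r"
    define a L l where "a = ln r" and "L = ln t" and "l = ln (2 * r)"
    have l: "l \<ge> 1 / 2" unfolding l_def using r by (intro ln_ge_half) auto
    have L: "L \<ge> 1 / 2" unfolding L_def using r t by (intro ln_ge_half) auto
    have a: "a > 0" using r by (simp add: a_def)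
    define W where "W = a * l ^ (2 * J + 1)"
    have W: "W \<ge> 0" using a l by (simp add: W_def)
    \<comment> \<open>The remainder has order \<open>2 * J + 2\<close>, which is
      \<open>n + 1\<close> for odd \<open>n\<close> and \<open>n + 2\<close> for even
      \<open>n\<close>.\<close>
    have "L ^ (n + 1) \<le> ?Q * L ^ (2 * J + 2)"
      using L by (intro power_le_two_power_mult_power) (auto simp: J_def)
    then have "1 / L ^ (2 * J + 2) \<le> ?Q * (1 / L ^ (n + 1))"
      using L by (simp add: field_simps del: power_Suc power_add)
    then have "4 * W * (1 / L ^ (2 * J + 2)) \<le> 4 * W * (?Q * (1 / L ^ (n + 1)))"
      using W by (intro mult_left_mono) auto
    with integrand_approx[OF r t, of J]
    have 1: "\<bar>(ln (ln (sqrt (r * t))) - ln (ln (sqrt (t / r)))) / ln t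
      - (\<Sum>i<J. 2 * ln r ^ (2 * i + 1) / real (2 * i + 1) / ln t ^ (2 * i + 2))\<bar>
      \<le> 4 * W * (?Q * (1 / L ^ (n + 1)))"
      by (simp add: W_def a_def l_def L_def)
    have "a_coeff (n - 1) r * l \<le> A * (a * l ^ (n - 1))"
      using A(2)[OF r] by (simp add: a_def l_def)
    also have "\<dots> \<le> A * (a * (?Q * l ^ (2 * J + 2)))"
      using l a A(1)
      by (intro mult_left_mono power_le_two_power_mult_power) (auto simp: J_def)
    also have "\<dots> = (A * ?Q * W) * l" by (simp add: W_def mult_ac)
    finally have "a_coeff (n - 1) r \<le> A * ?Q * W"
      using l by (simp add: mult_le_cancel_right)
    then have 2: "real n * a_coeff (n - 1) r * (1 / L ^ (n + 1))
        \<le> real n * (A * ?Q * W) * (1 / L ^ (n + 1))"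
      using L by (intro mult_right_mono mult_left_mono) auto
    have "real n * a_coeff (n - 1) r * (1 / L ^ (n + 1)) \<ge> 0"
      using L r by (intro mult_nonneg_nonneg a_coeff_nonneg) auto
    with 1 2 have "\<bar>(ln (ln (sqrt (r * t))) - ln (ln (sqrt (t / r)))) / ln t
      - ((\<Sum>i<J. 2 * ln r ^ (2 * i + 1) / real (2 * i + 1) / ln t ^ (2 * i + 2))
          - real n * a_coeff (n - 1) r * (1 / L ^ (n + 1)))\<bar>
      \<le> 4 * W * (?Q * (1 / L ^ (n + 1))) + real n * (A * ?Q * W) * (1 / L ^ (n + 1))"
      by linarith
    also have "\<dots> = (4 * ?Q + real n * A * ?Q) * W * (1 / L ^ (n + 1))"
      by (simp only: algebra_simps)
    finally show "\<bar>(ln (ln (sqrt (r * t))) - ln (ln (sqrt (t / r)))) / ln t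
      - ((\<Sum>i<J. 2 * ln r ^ (2 * i + 1) / real (2 * i + 1) / ln t ^ (2 * i + 2))
          - real n * a_coeff (n - 1) r / ln t ^ (n + 1))\<bar>
      \<le> (4 * ?Q + real n * A * ?Q) * (ln r * ln (2 * r) ^ (2 * J + 1)) * (1 / ln t ^ (n + 1))"
      by (simp add: W_def a_def l_def L_def)
  qed
qed

section \<open>Integration of the derivative error\<close>

text \<open>The constant is chosen before \<open>r\<close> and \<open>x\<close>, so it depends on
  \<open>n\<close> alone, and the bound holds on the whole range \<open>x >= 2 * r\<close>.\<close>

theorem theorem3:
  fixes n :: nat
  assumes "n \<ge> 2"
  shows "\<exists>C. \<forall>r x :: real. r > 1 \<longrightarrow> x \<ge> 2 * r \<longrightarrow>
    \<bar>F_int r x - (\<Sum>k = 1..n - 1. a_coeff k r * (x / ln x ^ (k + 1)))\<bar>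
      \<le> C * (x * ln (2 * r) ^ (2 * (n div 2) + 1) * ln r / ln x ^ (n + 1))"
proof -
  obtain K1 where K1: "K1 \<ge> 0" "\<And>r. r > 1 \<Longrightarrow>
      \<bar>\<Sum>k = 1..n - 1. a_coeff k r * (2 * r / ln (2 * r) ^ (k + 1))\<bar>
      \<le> K1 * (ln r * ln (2 * r) ^ (2 * (n div 2) + 1)) * (2 * r / ln (2 * r) ^ (n + 1))"
    using main_term_initial_bound by blast
  obtain K2 where K2: "K2 \<ge> 0" "\<And>r t. r > 1 \<Longrightarrow> t \<ge> 2 * r \<Longrightarrow>
      \<bar>(ln (ln (sqrt (r * t))) - ln (ln (sqrt (t / r)))) / ln t
      - ((\<Sum>i<n div 2. 2 * ln r ^ (2 * i + 1) / real (2 * i + 1) / ln t ^ (2 * i + 2))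
          - real n * a_coeff (n - 1) r / ln t ^ (n + 1))\<bar>
      \<le> K2 * (ln r * ln (2 * r) ^ (2 * (n div 2) + 1)) * (1 / ln t ^ (n + 1))"
    using deriv_error_bound by blast
  \<comment> \<open>The constant of \<open>div_ln_power_le\<close>, and half that of
    \<open>integral_inverse_ln_power_le\<close>, at exponent \<open>n + 1\<close>.\<close>
  define B where "B = (1 + 4 * real (n + 1)) ^ (n + 1)"
  show ?thesis
  proof (intro exI[of _ "K1 * B + K2 * (2 * B)"] allI impI)
    fix r x :: real assume r: "r > 1" and x: "x \<ge> 2 * r"
    define W where "W = ln r * ln (2 * r) ^ (2 * (n div 2) + 1)"
    define f where "f = (\<lambda>t. (ln (ln (sqrt (r * t))) - ln (ln (sqrt (t / r)))) / ln t)"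
    define g where "g = (\<lambda>t. (\<Sum>i<n div 2. 2 * ln r ^ (2 * i + 1) / real (2 * i + 1) / ln t ^ (2 * i + 2))
          - real n * a_coeff (n - 1) r / ln t ^ (n + 1))"
    define G where "G = (\<lambda>t. \<Sum>k = 1..n - 1. a_coeff k r * (t / ln t ^ (k + 1)))"
    have W: "W \<ge> 0" using r by (simp add: W_def)
    have c: "2 \<le> 2 * r" using r by simp
    have "(g has_integral G x - G (2 * r)) {2 * r..x}"
    proof (rule fundamental_theorem_of_calculus[OF x])
      fix t assume "t \<in> {2 * r..x}"
      then have t: "t > 1" using r by auto
      have n: "Suc (n - 1) = n" "n - 1 + 2 = n + 1" using assms by auto
      show "(G has_vector_derivative g t) (at t within {2 * r..x})"
        unfolding has_real_derivative_iff_has_vector_derivative[symmetric] G_def g_def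
        using has_real_derivative_main_term[OF t, where m = "n - 1" and r = r and S = "{2 * r..x}"]
        unfolding n .
    qed
    moreover have "(f has_integral F_int r x) {2 * r..x}"
      unfolding F_int_def f_def using F_integrand_integrable[OF r] by (rule integrable_integral)
    ultimately have fg: "((\<lambda>t. f t - g t) has_integral F_int r x - (G x - G (2 * r))) {2 * r..x}"
      by (rule has_integral_diff[rotated])
    have "\<bar>F_int r x - (G x - G (2 * r))\<bar> \<le> integral {2 * r..x} (\<lambda>t. K2 * W * (1 / ln t ^ (n + 1)))"
    proof -
      have "norm (integral {2 * r..x} (\<lambda>t. f t - g t))
          \<le> integral {2 * r..x} (\<lambda>t. K2 * W * (1 / ln t ^ (n + 1)))"
      proof (rule integral_norm_bound_integral)
        show "(\<lambda>t. f t - g t) integrable_on {2 * r..x}" using fg by blast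
        show "(\<lambda>t. K2 * W * (1 / ln t ^ (n + 1))) integrable_on {2 * r..x}"
          by (intro integrable_on_mult_right integrable_inverse_ln_power c)
        fix t assume "t \<in> {2 * r..x}"
        then show "norm (f t - g t) \<le> K2 * W * (1 / ln t ^ (n + 1))"
          using K2(2)[OF r, of t] by (simp add: f_def g_def W_def)
      qed
      then show ?thesis using integral_unique[OF fg] by simp
    qed
    also have "\<dots> = K2 * W * integral {2 * r..x} (\<lambda>t. 1 / ln t ^ (n + 1))"
      by (rule integral_mult_right)
    also have "\<dots> \<le> K2 * W * (2 * B * (x / ln x ^ (n + 1)))"
      unfolding B_def using integral_inverse_ln_power_le[OF c x, of "n + 1"] K2(1) W
      by (intro mult_left_mono mult_nonneg_nonneg)
    finally have 1: "\<bar>F_int r x - (G x - G (2 * r))\<bar> \<le> K2 * W * (2 * B * (x / ln x ^ (n + 1)))" .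
    \<comment> \<open>The lower boundary value is absent from the claimed main term and has to be
      absorbed into the error at \<open>x\<close>.\<close>
    have "\<bar>G (2 * r)\<bar> \<le> K1 * W * (2 * r / ln (2 * r) ^ (n + 1))"
      using K1(2)[OF r] by (simp add: G_def W_def)
    also have "\<dots> \<le> K1 * W * (B * (x / ln x ^ (n + 1)))"
      unfolding B_def using div_ln_power_le[OF c x, of "n + 1"] K1(1) W
      by (intro mult_left_mono mult_nonneg_nonneg)
    finally have "\<bar>F_int r x - G x\<bar>
        \<le> K2 * W * (2 * B * (x / ln x ^ (n + 1))) + K1 * W * (B * (x / ln x ^ (n + 1)))"
      using 1 by linarith
    also have "\<dots> = (K1 * B + K2 * (2 * B)) * (W * (x / ln x ^ (n + 1)))"
      by (simp only: algebra_simps)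
    also have "W * (x / ln x ^ (n + 1)) =
        x * ln (2 * r) ^ (2 * (n div 2) + 1) * ln r / ln x ^ (n + 1)"
      by (simp add: W_def mult_ac)
    finally show "\<bar>F_int r x - (\<Sum>k = 1..n - 1. a_coeff k r * (x / ln x ^ (k + 1)))\<bar>
        \<le> (K1 * B + K2 * (2 * B)) * (x * ln (2 * r) ^ (2 * (n div 2) + 1) * ln r / ln x ^ (n + 1))"
      by (simp only: G_def)
  qed
qed

end
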